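(* Consider the Markov matrix $U$ of the boundary driven rule-54 cellular automaton defined in the context at zero bias, i.e. with $\alpha=\beta\in[0,1]$ and $\gamma=\delta\in[0,1]$. Define $q^{\pm}:\{0,1\}^4\to\mathbb{R}$ by $$q^-_{ss'tt'}=4(ss'-s't),\qquad q^+_{ss'tt'}=4(s+s'+ss't+s'tt')-6(ss'+s't),$$ and for even $n$ let $Q^{\pm}\in\mathbb{R}^{2^n}$ be the vectors with components $$Q^{\pm}_{s_1,\dots,s_n}=\sum_{k=1}^{(n-4)/2}q^{\pm}_{s_{2k},s_{2k+1},s_{2k+2},s_{2k+3}} .$$ Then $Q^+$ and $Q^-$ are local conservation laws: there is an integer $r'$ independent of $n$ such that for every even $n\ge r'$ there exist vectors $g^{\pm},h^{\pm}\in\mathbb{R}^{2^{r'}}$ with $$(UQ^{\pm}-Q^{\pm})_{s_1,\dots,s_n}=g^{\pm}_{s_1,\dots,s_{r'}}+h^{\pm}_{s_{n-r'+1},\dots,s_n}\qquad\text{for all }(s_1,\dots,s_n)\in\{0,1\}^n .$$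
   Context: Model. Let $\mathbb{Z}_2=\{0,1\}$ and $\chi(w,c,e)= c+w+e+we \pmod 2$ for $w,c,e\in\mathbb{Z}_2$ (the middle argument is the cell being updated). Vectors in $\mathbb{R}^{2^n}=(\mathbb{R}^2)^{\otimes n}$ have components indexed by configurations $(s_1,\dots,s_n)\in\mathbb{Z}_2^n$; matrices act on column vectors (first index = row = final configuration, second index = column = initial configuration). Bulk: $P$ is the $8\times 8$ permutation matrix $P_{(s,s',s''),(t,t',t'')}=\delta_{s,t}\,\delta_{s',\chi(t,t',t'')}\,\delta_{s'',t''}$. Boundaries: $E^{\alpha,\beta}=\begin{pmatrix}1-\alpha&\beta\\ \alpha&1-\beta\end{pmatrix}$, $\tilde P^{\rm L}_{(s',s''),(t',t'')}=\frac12\sum_{s=0}^1 P_{(s,s',s''),(s,t',t'')}$, $\tilde P^{\rm R}_{(s,s'),(t,t')}=\frac12\sum_{s''=0}^1 P_{(s,s',s''),(t,t',s'')}$, $P^{\rm L}=\tilde P^{\rm L}(E^{\alpha,\beta}\otimes \mathbb{1}_2)$, $P^{\rm R}=\tilde P^{\rm R}(\mathbb{1}_2\otimes E^{\gamma,\delta})$. Propagator (for even $n\ge4$): with $P_{k,k+1,k+2}=\mathbb{1}_{2^{k-1}}\otimes P\otimes \mathbb{1}_{2^{n-k-2}}$, $P^{\rm L}_{12}=P^{\rm L}\otimes \mathbb{1}_{2^{n-2}}$, $P^{\rm R}_{n-1,n}=\mathbb{1}_{2^{n-2}}\otimes P^{\rm R}$, put $U_{\rm e}=P_{123}P_{345}\cdots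 P_{n-3,n-2,n-1}P^{\rm R}_{n-1,n}$, $U_{\rm o}=P_{n-2,n-1,n}\cdots P_{456}P_{234}P^{\rm L}_{12}$, $U=U_{\rm o}U_{\rm e}$. *)

theory Defs
  imports Complex_Main "HOL-Library.Z2"
begin

text \<open>
  The two-element type \<^typ>\<open>bit\<close> is the ring of integers modulo 2. A configuration
  $(s_1,\dots,s_n)$ is a list of length $n$, whose entry \<open>s ! (k - 1)\<close> is $s_k$. Vectors and matrices
  on $(\mathbb{R}^2)^{\otimes n}$ are functions of one or two configurations, of which only the
  values on \<open>configs n\<close> are meaningful; the number of sites is passed explicitly where needed.
  In matrices the first argument is the row (final configuration).
\<close>

type_synonym config = "bit list"
type_synonym cvec = "config \<Rightarrow> real"
type_synonym cmat = "config \<Rightarrow> config \<Rightarrow> real"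

definition configs :: "nat \<Rightarrow> config set" where
  "configs n = {s. length s = n}"

definition site :: "config \<Rightarrow> nat \<Rightarrow> bit" where
  "site s k = s ! (k - 1)"

definition delta :: "'a \<Rightarrow> 'a \<Rightarrow> real" where
  "delta x y = of_bool (x = y)"

definition ident :: cmat where
  "ident s t = delta s t"

definition mvec :: "nat \<Rightarrow> cmat \<Rightarrow> cvec \<Rightarrow> cvec" where
  "mvec n A v s = (\<Sum>t\<in>configs n. A s t * v t)"

definition mmul :: "nat \<Rightarrow> cmat \<Rightarrow> cmat \<Rightarrow> cmat" where
  "mmul n A B s t = (\<Sum>u\<in>configs n. A s u * B u t)"

definition mprod :: "nat \<Rightarrow> cmat list \<Rightarrow> cmat" where
  "mprod n As = foldr (mmul n) As ident"

text \<open>The tensor product $A \otimes B$, where \<open>m\<close> is the number of sites that \<open>A\<close> acts on.\<close>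

definition kron :: "nat \<Rightarrow> cmat \<Rightarrow> cmat \<Rightarrow> cmat" where
  "kron m A B s t = A (take m s) (take m t) * B (drop m s) (drop m t)"

definition chi :: "bit \<Rightarrow> bit \<Rightarrow> bit \<Rightarrow> bit" where
  "chi w c e = c + w + e + w * e"

definition P :: cmat where
  "P s t = delta (site s 1) (site t 1)
         * delta (site s 2) (chi (site t 1) (site t 2) (site t 3))
         * delta (site s 3) (site t 3)"

definition E :: "real \<Rightarrow> real \<Rightarrow> cmat" where
  "E \<alpha> \<beta> s t =
     (if site t 1 = 0 then (if site s 1 = 0 then 1 - \<alpha> else \<alpha>)
      else (if site s 1 = 0 then \<beta> else 1 - \<beta>))"

definition P_tilde_L :: cmat where
  "P_tilde_L s t = 1/2 * (\<Sum>x\<in>{0,1}. P (x # s) (x # t))"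

definition P_tilde_R :: cmat where
  "P_tilde_R s t = 1/2 * (\<Sum>x\<in>{0,1}. P (s @ [x]) (t @ [x]))"

definition P_L :: "real \<Rightarrow> real \<Rightarrow> cmat" where
  "P_L \<alpha> \<beta> = mmul 2 P_tilde_L (kron 1 (E \<alpha> \<beta>) ident)"

definition P_R :: "real \<Rightarrow> real \<Rightarrow> cmat" where
  "P_R \<gamma> \<delta> = mmul 2 P_tilde_R (kron 1 ident (E \<gamma> \<delta>))"

definition P_bulk :: "nat \<Rightarrow> cmat" where
  "P_bulk k = kron (k - 1) ident (kron 3 P ident)"

definition P_left :: "real \<Rightarrow> real \<Rightarrow> cmat" where
  "P_left \<alpha> \<beta> = kron 2 (P_L \<alpha> \<beta>) ident"

definition P_right :: "nat \<Rightarrow> real \<Rightarrow> real \<Rightarrow> cmat" where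
  "P_right n \<gamma> \<delta> = kron (n - 2) ident (P_R \<gamma> \<delta>)"

text \<open>
  The propagator is meaningful for even $n \ge 4$. The list below ranges over
  $j = 1, \dots, (n-2)/2$.
\<close>

definition U_e :: "nat \<Rightarrow> real \<Rightarrow> real \<Rightarrow> cmat" where
  "U_e n \<gamma> \<delta> =
     mprod n (map (\<lambda>j. P_bulk (2 * j - 1)) [1..<n div 2] @ [P_right n \<gamma> \<delta>])"

definition U_o :: "nat \<Rightarrow> real \<Rightarrow> real \<Rightarrow> cmat" where
  "U_o n \<alpha> \<beta> =
     mprod n (map (\<lambda>j. P_bulk (2 * j)) (rev [1..<n div 2]) @ [P_left \<alpha> \<beta>])"

definition U :: "nat \<Rightarrow> real \<Rightarrow> real \<Rightarrow> real \<Rightarrow> real \<Rightarrow> cmat" where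
  "U n \<alpha> \<beta> \<gamma> \<delta> = mmul n (U_o n \<alpha> \<beta>) (U_e n \<gamma> \<delta>)"

abbreviation val :: "bit \<Rightarrow> real" where
  "val \<equiv> of_bit"

definition q_minus :: "bit \<Rightarrow> bit \<Rightarrow> bit \<Rightarrow> bit \<Rightarrow> real" where
  "q_minus s s' t t' = 4 * (val s * val s' - val s' * val t)"

definition q_plus :: "bit \<Rightarrow> bit \<Rightarrow> bit \<Rightarrow> bit \<Rightarrow> real" where
  "q_plus s s' t t' =
     4 * (val s + val s' + val s * val s' * val t + val s' * val t * val t')
     - 6 * (val s * val s' + val s' * val t)"

definition Q_of :: "(bit \<Rightarrow> bit \<Rightarrow> bit \<Rightarrow> bit \<Rightarrow> real) \<Rightarrow> nat \<Rightarrow> cvec" where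
  "Q_of q n s = (\<Sum>k=1..(n - 4) div 2.
     q (site s (2 * k)) (site s (2 * k + 1)) (site s (2 * k + 2)) (site s (2 * k + 3)))"

definition Q_plus :: "nat \<Rightarrow> cvec" where
  "Q_plus = Q_of q_plus"

definition Q_minus :: "nat \<Rightarrow> cvec" where
  "Q_minus = Q_of q_minus"

end

theory Submission
  imports Defs
begin

text \<open>
  Every bulk gate is an involution that updates one site from its two neighbours, so that \<open>U Q\<close> is
  \<open>Q\<close> evaluated at an updated configuration, up to the noise at the two ends. At zero bias the boundary
  matrices are doubly stochastic, hence they fix every vector that does not depend on the outermost
  site: the right noise never touches \<open>Q\<close>, and the left noise only touches its first summand.
  For each remaining summand, the update changes the density by a difference
  \<open>J(s\<^sub>2\<^sub>k, \<dots>, s\<^sub>2\<^sub>k\<^sub>+\<^sub>4) - J(s\<^sub>2\<^sub>k\<^sub>-\<^sub>2, \<dots>, s\<^sub>2\<^sub>k\<^sub>+\<^sub>2)\<close> of a five-site current, and these differences telescope.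
\<close>

section \<open>Sums over configurations and matrix-vector products\<close>

lemma sum_configs_0: "(\<Sum>t\<in>configs 0. f t) = f []"
proof -
  have "configs 0 = {[]}" by (auto simp: configs_def)
  then show ?thesis by simp
qed

lemma UNIV_bit: "(UNIV :: bit set) = {0, 1}"
proof -
  have "x = 0 \<or> x = 1" for x :: bit by (cases x) simp_all
  then show ?thesis by auto
qed

lemma finite_configs [simp]: "finite (configs n)"
proof -
  have "finite (UNIV :: bit set)" by (simp add: UNIV_bit)
  from finite_lists_length_eq[OF this, of n] show ?thesis by (simp add: configs_def)
qed

lemma sum_configs_add:
  fixes f :: "config \<Rightarrow> real"
  shows "(\<Sum>t\<in>configs (m + k). f t) = (\<Sum>u\<in>configs m. \<Sum>w\<in>configs k. f (u @ w))"
proof -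
  have "(\<Sum>u\<in>configs m. \<Sum>w\<in>configs k. f (u @ w)) = (\<Sum>(u, w)\<in>configs m \<times> configs k. f (u @ w))"
    by (simp add: sum.cartesian_product)
  also have "\<dots> = (\<Sum>t\<in>configs (m + k). f t)"
    by (rule sum.reindex_bij_witness[where i = "\<lambda>t. (take m t, drop m t)" and j = "\<lambda>(u, w). u @ w"])
       (auto simp: configs_def)
  finally show ?thesis by simp
qed

lemma sum_configs_1:
  fixes f :: "config \<Rightarrow> real"
  shows "(\<Sum>t\<in>configs (Suc 0). f t) = f [0] + f [1]"
proof -
  have "(\<Sum>t\<in>configs (Suc 0). f t) = (\<Sum>x\<in>UNIV. f [x])"
    by (rule sum.reindex_bij_witness[where i = "\<lambda>x. [x]" and j = hd])
       (auto simp: configs_def length_Suc_conv)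
  then show ?thesis by (simp add: UNIV_bit)
qed

lemma sum_configs_Suc:
  fixes f :: "config \<Rightarrow> real"
  shows "(\<Sum>t\<in>configs (Suc n). f t) = (\<Sum>t\<in>configs n. f (0 # t)) + (\<Sum>t\<in>configs n. f (1 # t))"
  using sum_configs_add[of f 1 n] by (simp add: sum_configs_1)

lemma mvec_cong:
  assumes "\<And>t. t \<in> configs n \<Longrightarrow> v t = w t"
  shows "mvec n A v s = mvec n A w s"
  unfolding mvec_def using assms by (auto intro: sum.cong)

lemma mvec_mmul: "mvec n (mmul n A B) v s = mvec n A (mvec n B v) s"
proof -
  have "mvec n (mmul n A B) v s = (\<Sum>t\<in>configs n. \<Sum>u\<in>configs n. A s u * B u t * v t)"
    by (simp add: mvec_def mmul_def sum_distrib_right)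
  also have "\<dots> = (\<Sum>u\<in>configs n. \<Sum>t\<in>configs n. A s u * B u t * v t)"
    by (rule sum.swap)
  finally show ?thesis
    by (simp add: mvec_def sum_distrib_left mult.assoc)
qed

lemma mvec_ident:
  assumes "length s = n"
  shows "mvec n ident v s = v s"
proof -
  have "mvec n ident v s = (\<Sum>t\<in>configs n. if t = s then v t else 0)"
    by (auto simp: mvec_def ident_def delta_def intro!: sum.cong)
  moreover have "s \<in> configs n" using assms by (simp add: configs_def)
  ultimately show ?thesis by simp
qed

lemma mvec_kron:
  assumes "length s = n" "m \<le> n"
  shows "mvec n (kron m A B) v s
    = mvec m A (\<lambda>u. mvec (n - m) B (\<lambda>w. v (u @ w)) (drop m s)) (take m s)"
proof -
  obtain k where k: "n = m + k" using assms(2) le_Suc_ex by blast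
  show ?thesis
    unfolding mvec_def k sum_configs_add
    by (auto simp: kron_def configs_def sum_distrib_left mult.assoc intro!: sum.cong)
qed

section \<open>Bulk gates as updates of the row configuration\<close>

definition update :: "nat \<Rightarrow> config \<Rightarrow> config" where
  "update k s = s[k := chi (s ! (k - 1)) (s ! k) (s ! Suc k)]"

lemma length_update [simp]: "length (update k s) = length s"
  by (simp add: update_def)

lemma nth_update:
  assumes "i < length s"
  shows "update k s ! i = (if i = k then chi (s ! (k - 1)) (s ! k) (s ! Suc k) else s ! i)"
  using assms by (simp add: update_def nth_list_update)

text \<open>Modulo 2, \<open>chi a (chi a b c) c = b\<close>, so row \<open>[a, b, c]\<close> of
  \<open>P\<close> has its only nonzero entry in column \<open>[a, chi a b c, c]\<close>.\<close>

lemma mvec_P: "mvec 3 P v [a, b, c] = v [a, chi a b c, c]"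
  unfolding numeral_3_eq_3
  by (cases a; cases b; cases c)
     (simp_all add: mvec_def sum_configs_Suc sum_configs_0 P_def site_def delta_def chi_def)

text \<open>The middle site of the gate on sites k, k+1, k+2 is site k+1, which is list position
  \<open>k\<close> counted from zero.\<close>

lemma mvec_P_bulk:
  assumes "length s = n" "1 \<le> k" "Suc k < n"
  shows "mvec n (P_bulk k) v s = v (update k s)"
proof -
  define u where "u = take (k - 1) s"
  have lu: "length u = k - 1" and k: "k = Suc (length u)" using assms by (simp_all add: u_def)
  have "length (drop (k - 1) s) = Suc (Suc (Suc (n - k - 2)))" using assms by simp
  then obtain a b c d where "drop (k - 1) s = a # b # c # d"
    unfolding length_Suc_conv by blast
  then have s: "s = u @ a # b # c # d"
    by (metis append_take_drop_id u_def)
  have "update k s = u @ a # chi a b c # c # d"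
    unfolding s k by (simp add: update_def nth_append list_update_append)
  moreover have "mvec n (P_bulk k) v s = v (u @ a # chi a b c # c # d)"
    unfolding assms(1)[symmetric] s k
    by (simp add: P_bulk_def mvec_kron mvec_ident mvec_P)
  ultimately show ?thesis by simp
qed

lemma length_fold_update [simp]: "length (fold update ks s) = length s"
  by (induction ks arbitrary: s) auto

text \<open>The leftmost gate is the first to rewrite the row index, so the updates run in the order
  in which the gates are listed, and \<open>A\<close> meets the fully updated row.\<close>

lemma mvec_mprod_P_bulk:
  assumes "length s = n" "\<And>k. k \<in> set ks \<Longrightarrow> 1 \<le> k \<and> Suc k < n"
  shows "mvec n (mprod n (map P_bulk ks @ [A])) v s = mvec n A v (fold update ks s)"
  using assms
proof (induction ks arbitrary: s)
  case Nil
  have "mvec n (mmul n A ident) v s = mvec n A v s"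
    unfolding mvec_mmul by (rule mvec_cong) (simp add: mvec_ident configs_def)
  then show ?case by (simp add: mprod_def)
next
  case (Cons k ks)
  then show ?case by (simp add: mprod_def mvec_mmul mvec_P_bulk)
qed

text \<open>Updates at sites of equal parity do not read each other's output, so they act simultaneously.\<close>

lemma nth_fold_update:
  assumes "distinct ks" "i < length s"
    and "\<And>k. k \<in> set ks \<Longrightarrow> 1 \<le> k \<and> Suc k < length s \<and> (even k \<longleftrightarrow> p)"
  shows "fold update ks s ! i
    = (if i \<in> set ks then chi (s ! (i - 1)) (s ! i) (s ! Suc i) else s ! i)"
  using assms
proof (induction ks arbitrary: s)
  case Nil
  then show ?case by simp
next
  case (Cons k ks)
  have IH: "fold update ks (update k s) ! i
    = (if i \<in> set ks then chi (update k s ! (i - 1)) (update k s ! i) (update k s ! Suc i)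
       else update k s ! i)"
    using Cons by (intro Cons.IH) auto
  have nb: "i - 1 \<noteq> k \<and> Suc i \<noteq> k \<and> i \<noteq> k \<and> Suc i < length s" if "i \<in> set ks"
  proof -
    have "1 \<le> i" "even i = even k" "i \<noteq> k" "Suc i < length s" using Cons.prems that by auto
    then show ?thesis by (cases i) auto
  qed
  show ?case using IH nb Cons.prems(2) by (auto simp: nth_update)
qed

text \<open>Named after sites counted from one: the gates of \<open>U_e\<close> update sites 2, 4,
  ..., n-2, which are odd list positions.\<close>

definition evens :: "nat \<Rightarrow> config \<Rightarrow> config" where
  "evens n = fold update (map (\<lambda>j. 2 * j - 1) [1..<n div 2])"

definition odds :: "nat \<Rightarrow> config \<Rightarrow> config" where
  "odds n = fold update (map (\<lambda>j. 2 * j) (rev [1..<n div 2]))"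

lemma length_evens [simp]: "length (evens n s) = length s"
  and length_odds [simp]: "length (odds n s) = length s"
  by (simp_all add: evens_def odds_def)

lemma nth_evens:
  assumes "length s = n" "i < n" "even n"
  shows "evens n s ! i
    = (if odd i \<and> i + 2 < n then chi (s ! (i - 1)) (s ! i) (s ! Suc i) else s ! i)"
proof -
  define ks where "ks = map (\<lambda>j. 2 * j - 1) [1..<n div 2]"
  have mem: "k \<in> set ks \<longleftrightarrow> odd k \<and> k + 2 < n" for k
  proof
    assume "odd k \<and> k + 2 < n"
    then have "k = 2 * Suc (k div 2) - 1" "Suc (k div 2) \<in> set [1..<n div 2]"
      using \<open>even n\<close> by (auto elim!: oddE evenE)
    then show "k \<in> set ks"
      unfolding ks_def set_map by (rule image_eqI)
  next
    assume "k \<in> set ks"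
    then obtain j where "k = 2 * j - 1" "1 \<le> j" "j < n div 2"
      by (auto simp: ks_def)
    then show "odd k \<and> k + 2 < n"
      using \<open>even n\<close> by (cases j) (auto elim!: evenE)
  qed
  have "distinct ks"
    by (auto simp: ks_def distinct_map inj_on_def)
  then show ?thesis
    unfolding evens_def ks_def[symmetric] using assms
    by (subst nth_fold_update[where p = False]) (auto simp: mem odd_pos Suc_leI)
qed

lemma nth_odds:
  assumes "length s = n" "i < n" "even n"
  shows "odds n s ! i
    = (if even i \<and> 0 < i then chi (s ! (i - 1)) (s ! i) (s ! Suc i) else s ! i)"
proof -
  define ks where "ks = map (\<lambda>j. 2 * j) (rev [1..<n div 2])"
  have mem: "k \<in> set ks \<longleftrightarrow> even k \<and> 0 < k \<and> Suc k < n" for k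
    using \<open>even n\<close> by (auto simp: ks_def elim!: evenE)
  have "distinct ks"
    by (auto simp: ks_def distinct_map inj_on_def)
  moreover have "Suc i < n" if "even i"
    using that assms by (auto elim!: evenE)
  ultimately show ?thesis
    unfolding odds_def ks_def[symmetric] using assms
    by (subst nth_fold_update[where p = True]) (auto simp: mem)
qed

section \<open>Boundary noise at equal rates and the full propagator\<close>

lemma mvec_P_right:
  assumes "length s = n" "2 \<le> n"
    and "\<And>u a b b'. length u = n - 2 \<Longrightarrow> v (u @ [a, b]) = v (u @ [a, b'])"
  shows "mvec n (P_right n \<gamma> \<gamma>) v s = v s"
proof -
  \<comment> \<open>Row \<open>[a, b]\<close> of \<open>P_R\<close> is supported on columns starting
    with \<open>a\<close>. Its entries sum to 1 because the rows of
    \<open>E \<gamma> \<gamma>\<close> do; with unequal rates the rows of \<open>E\<close> no longer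
    sum to 1.\<close>
  have P_R: "mvec 2 (P_R \<gamma> \<gamma>) w [a, b] = w [a, b]"
    if "\<And>a b b'. w [a, b] = w [a, b']" for w :: cvec and a b
  proof -
    have w: "w [x, y] = w [x, 0]" for x y by (rule that)
    show ?thesis
      unfolding P_R_def mvec_mmul
      by (cases a; cases b)
         (simp_all add: mvec_def numeral_2_eq_2 sum_configs_Suc sum_configs_0 P_tilde_R_def P_def
           site_def delta_def chi_def kron_def ident_def E_def w[of _ 1] field_simps)
  qed
  define m where "m = n - 2"
  then have m: "n - m = 2" "m \<le> n" using assms(2) by auto
  have "length (drop m s) = Suc (Suc 0)" using assms m by simp
  then obtain a b where d: "drop m s = [a, b]" unfolding length_Suc_conv by auto
  have "mvec n (P_right n \<gamma> \<gamma>) v s = mvec 2 (P_R \<gamma> \<gamma>) (\<lambda>w. v (take m s @ w)) [a, b]"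
    using assms m d by (simp add: P_right_def mvec_kron mvec_ident flip: m_def)
  also have "\<dots> = v (take m s @ [a, b])"
    using assms m by (intro P_R) (auto simp: m_def)
  finally show ?thesis by (metis append_take_drop_id d)
qed

lemma mvec_P_L_const:
  assumes "\<And>a a' b. w [a, b] = w [a', b]"
  shows "mvec 2 (P_L \<alpha> \<alpha>) w [a, b] = w [a, b]"
proof -
  have w: "w [x, y] = w [0, y]" for x y by (rule assms)
  show ?thesis
    unfolding P_L_def mvec_mmul
    by (cases a; cases b)
       (simp_all add: mvec_def numeral_2_eq_2 sum_configs_Suc sum_configs_0 P_tilde_L_def P_def
         site_def delta_def chi_def kron_def ident_def E_def w[of 1] field_simps)
qed

lemma mvec_P_left:
  assumes "length s = n" "2 \<le> n"
  shows "mvec n (P_left \<alpha> \<beta>) v s = mvec 2 (P_L \<alpha> \<beta>) (\<lambda>u. v (u @ drop 2 s)) [s ! 0, s ! 1]"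
proof -
  have "take 2 s = [s ! 0, s ! 1]"
    using assms by (intro nth_equalityI) (auto simp: numeral_2_eq_2 less_Suc_eq nth_Cons')
  then show ?thesis
    using assms by (simp add: P_left_def mvec_kron mvec_ident)
qed

lemma mvec_add: "mvec n A (\<lambda>t. v t + w t) s = mvec n A v s + mvec n A w s"
  by (simp add: mvec_def distrib_left sum.distrib)

text \<open>In \<open>U_o\<close> times \<open>U_e\<close> the row index meets the odd-site gates
  first, then the left noise, then the even-site gates. The right noise comes last and fixes
  \<open>v\<close>, which does not read site n.\<close>

lemma mvec_U:
  assumes "length s = n" "2 \<le> n" "even n"
    and last: "\<And>u a b b'. length u = n - 2 \<Longrightarrow> v (u @ [a, b]) = v (u @ [a, b'])"
  shows "mvec n (U n \<alpha> \<beta> \<gamma> \<gamma>) v s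
    = mvec n (P_left \<alpha> \<beta>) (\<lambda>t. v (evens n t)) (odds n s)"
proof -
  have e: "mvec n (U_e n \<gamma> \<gamma>) v t = v (evens n t)" if "t \<in> configs n" for t
  proof -
    from that have t: "length t = n" by (simp add: configs_def)
    have "map (\<lambda>j. P_bulk (2 * j - 1)) [1..<n div 2] = map P_bulk (map (\<lambda>j. 2 * j - 1) [1..<n div 2])"
      by simp
    then have "mvec n (U_e n \<gamma> \<gamma>) v t = mvec n (P_right n \<gamma> \<gamma>) v (evens n t)"
      unfolding U_e_def evens_def using t by (simp only:) (rule mvec_mprod_P_bulk, auto)
    then show ?thesis using t assms by (simp add: mvec_P_right)
  qed
  have "map (\<lambda>j. P_bulk (2 * j)) (rev [1..<n div 2]) = map P_bulk (map (\<lambda>j. 2 * j) (rev [1..<n div 2]))"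
    by simp
  then have "mvec n (U n \<alpha> \<beta> \<gamma> \<gamma>) v s = mvec n (P_left \<alpha> \<beta>) (mvec n (U_e n \<gamma> \<gamma>) v) (odds n s)"
    unfolding U_def U_o_def odds_def mvec_mmul using assms
    by (simp only:) (rule mvec_mprod_P_bulk, auto elim!: evenE)
  then show ?thesis by (simp add: e cong: mvec_cong)
qed

section \<open>Local conservation from a current\<close>

type_synonym density = "bit \<Rightarrow> bit \<Rightarrow> bit \<Rightarrow> bit \<Rightarrow> real"
type_synonym current = "bit \<Rightarrow> bit \<Rightarrow> bit \<Rightarrow> bit \<Rightarrow> bit \<Rightarrow> real"

text \<open>A discrete continuity equation on seven consecutive sites, with \<open>a\<close>,
  \<open>c\<close>, \<open>e\<close>, \<open>g\<close> at even ones. Odd sites move first, to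
  \<open>b'\<close>, \<open>d'\<close>, \<open>f'\<close>; then \<open>c\<close> and
  \<open>e\<close> are updated from these new values. The two currents are two sites apart.\<close>

definition has_current :: "density \<Rightarrow> current \<Rightarrow> bool" where
  "has_current q J \<longleftrightarrow> (\<forall>a b c d e f g.
     let b' = chi a b c; d' = chi c d e; f' = chi e f g in
     q (chi b' c d') d' (chi d' e f') f' - q c d e f = J c d e f g - J a b c d e)"

text \<open>The second and fourth arguments sit at odd sites, which \<open>evens\<close> leaves
  alone. For k at least 1, only k = 1 reads list positions 0 and 1, the two sites on which
  \<open>P_L\<close> acts.\<close>

definition summand_after_evens :: "density \<Rightarrow> config \<Rightarrow> nat \<Rightarrow> real" where
  "summand_after_evens q t k =
     q (chi (t ! (2*k - 2)) (t ! (2*k - 1)) (t ! (2*k))) (t ! (2*k))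
       (chi (t ! (2*k)) (t ! (2*k + 1)) (t ! (2*k + 2))) (t ! (2*k + 2))"

lemma Q_of_evens:
  assumes "length t = n" "even n"
  shows "Q_of q n (evens n t) = (\<Sum>k=1..(n - 4) div 2. summand_after_evens q t k)"
  unfolding Q_of_def
proof (rule sum.cong[OF refl])
  fix k assume "k \<in> {1..(n - 4) div 2}"
  then have k: "1 \<le> k" "2 * k + 4 \<le> n" using \<open>even n\<close> by (auto elim!: evenE)
  then obtain m where m: "2 * k = Suc (Suc m)" by (cases k) auto
  then have "even m" by presburger
  show "q (site (evens n t) (2 * k)) (site (evens n t) (2 * k + 1))
      (site (evens n t) (2 * k + 2)) (site (evens n t) (2 * k + 3)) = summand_after_evens q t k"
    using k assms \<open>even m\<close> unfolding summand_after_evens_def m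
    by (simp add: site_def nth_evens numeral_3_eq_3)
qed

text \<open>The last summand, k = (n-4)/2, ends at site n-1.\<close>

lemma Q_of_last:
  assumes "length u = n - 2" "even n"
  shows "Q_of q n (u @ [a, b]) = Q_of q n (u @ [a, b'])"
  unfolding Q_of_def
  by (intro sum.cong refl) (use assms in \<open>auto simp: site_def nth_append nth_Cons' elim!: evenE\<close>)

text \<open>The first summand after a full step, minus its old value and minus the lower boundary
  term of the telescoping sum. The inner \<open>chi\<close> terms are sites 3 and 5 after the odd
  half step. Only list positions 0 to 5 occur.\<close>

definition left_part :: "real \<Rightarrow> density \<Rightarrow> current \<Rightarrow> cvec" where
  "left_part \<alpha> q J s =
     mvec 2 (P_L \<alpha> \<alpha>)
       (\<lambda>u. q (chi (u ! 0) (u ! 1) (chi (s ! 1) (s ! 2) (s ! 3))) (chi (s ! 1) (s ! 2) (s ! 3))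
              (chi (chi (s ! 1) (s ! 2) (s ! 3)) (s ! 3) (chi (s ! 3) (s ! 4) (s ! 5)))
              (chi (s ! 3) (s ! 4) (s ! 5)))
       [s ! 0, s ! 1]
     - q (s ! 1) (s ! 2) (s ! 3) (s ! 4) - J (s ! 1) (s ! 2) (s ! 3) (s ! 4) (s ! 5)"

text \<open>From n = 8 on there are at least two summands: the first absorbs the left noise, the
  others telescope. The upper boundary current ends at list position \<open>2 * K + 3\<close>, which
  is n-1, so it occupies positions 3 to 7 of the last eight.\<close>

lemma local_conservation:
  assumes J: "has_current q J" and n: "8 \<le> n" "even n" and s: "s \<in> configs n"
  shows "mvec n (U n \<alpha> \<alpha> \<gamma> \<gamma>) (Q_of q n) s - Q_of q n s
    = left_part \<alpha> q J (take 8 s)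
      + (\<lambda>w. J (w ! 3) (w ! 4) (w ! 5) (w ! 6) (w ! 7)) (drop (n - 8) s)"
proof -
  define K where "K = (n - 4) div 2"
  have K: "2 \<le> K" "2 * K + 4 = n" using n by (auto simp: K_def elim!: evenE)
  from s have len: "length s = n" by (simp add: configs_def)
  define t where "t = odds n s"
  have lt: "length t = n" by (simp add: t_def len)
  have split: "(\<Sum>k=1..K. f k) = f 1 + (\<Sum>k=2..K. f k)" for f :: "nat \<Rightarrow> real"
    using K(1) by (subst sum.atLeast_Suc_atMost) (auto simp: numeral_2_eq_2)
  have tail: "(\<Sum>k=2..K. summand_after_evens q (u @ drop 2 t) k) = (\<Sum>k=2..K. summand_after_evens q t k)"
    if "length u = 2" for u
  proof (intro sum.cong refl)
    fix k assume k: "k \<in> {2..K}"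
    have nth: "(u @ drop 2 t) ! i = t ! i" if "2 \<le> i" for i
      using that \<open>length u = 2\<close> lt K by (simp add: nth_append del: add_2_eq_Suc)
    have le: "2 \<le> 2 * k - 2" "2 \<le> 2 * k - 1" using k by auto
    show "summand_after_evens q (u @ drop 2 t) k = summand_after_evens q t k"
      using k nth[OF le(1)] nth[OF le(2)] by (simp add: summand_after_evens_def nth)
  qed
  have "mvec n (U n \<alpha> \<alpha> \<gamma> \<gamma>) (Q_of q n) s = mvec n (P_left \<alpha> \<alpha>) (\<lambda>t. Q_of q n (evens n t)) t"
    unfolding t_def using len n Q_of_last by (intro mvec_U) auto
  also have "\<dots> = mvec n (P_left \<alpha> \<alpha>) (\<lambda>t. \<Sum>k=1..K. summand_after_evens q t k) t"
    using n by (intro mvec_cong) (simp add: Q_of_evens configs_def K_def)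
  also have "\<dots> = mvec 2 (P_L \<alpha> \<alpha>)
      (\<lambda>u. summand_after_evens q (u @ drop 2 t) 1 + (\<Sum>k=2..K. summand_after_evens q t k)) [t ! 0, t ! 1]"
    using lt n unfolding split
    by (subst mvec_P_left) (auto simp: configs_def tail intro!: mvec_cong)
  \<comment> \<open>The sum from k = 2 on is constant in \<open>u\<close>, so the left noise fixes
    it.\<close>
  also have "\<dots> = mvec 2 (P_L \<alpha> \<alpha>) (\<lambda>u. summand_after_evens q (u @ drop 2 t) 1) [t ! 0, t ! 1]
      + (\<Sum>k=2..K. summand_after_evens q t k)"
    by (simp add: mvec_add mvec_P_L_const)
  finally have U: "mvec n (U n \<alpha> \<alpha> \<gamma> \<gamma>) (Q_of q n) s = \<dots>" .
  have first: "mvec 2 (P_L \<alpha> \<alpha>) (\<lambda>u. summand_after_evens q (u @ drop 2 t) 1) [t ! 0, t ! 1]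
      = left_part \<alpha> q J (take 8 s) + q (s ! 1) (s ! 2) (s ! 3) (s ! 4)
        + J (s ! 1) (s ! 2) (s ! 3) (s ! 4) (s ! 5)"
  proof -
    have t_eq: "t ! 0 = s ! 0" "t ! 1 = s ! 1" "t ! 2 = chi (s ! 1) (s ! 2) (s ! 3)"
      "t ! 3 = s ! 3" "t ! 4 = chi (s ! 3) (s ! 4) (s ! 5)"
      using len n by (simp_all add: t_def nth_odds)
    have "summand_after_evens q (u @ drop 2 t) 1
      = q (chi (u ! 0) (u ! 1) (t ! 2)) (t ! 2) (chi (t ! 2) (t ! 3) (t ! 4)) (t ! 4)"
      if "u \<in> configs 2" for u
      using that lt n by (simp add: summand_after_evens_def configs_def nth_append)
    then have "mvec 2 (P_L \<alpha> \<alpha>) (\<lambda>u. summand_after_evens q (u @ drop 2 t) 1) [t ! 0, t ! 1]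
      = mvec 2 (P_L \<alpha> \<alpha>)
          (\<lambda>u. q (chi (u ! 0) (u ! 1) (t ! 2)) (t ! 2) (chi (t ! 2) (t ! 3) (t ! 4)) (t ! 4))
          [t ! 0, t ! 1]"
      by (rule mvec_cong)
    then show ?thesis
      using t_eq by (simp add: left_part_def)
  qed
  let ?j = "\<lambda>k. J (s ! (2*k - 1)) (s ! (2*k)) (s ! (2*k + 1)) (s ! (2*k + 2)) (s ! (2*k + 3))"
  let ?q = "\<lambda>k. q (s ! (2*k - 1)) (s ! (2*k)) (s ! (2*k + 1)) (s ! (2*k + 2))"
  \<comment> \<open>The window \<open>a\<close>, ..., \<open>g\<close> of \<open>has_current\<close>
    is placed at list positions 2k-3 to 2k+3; writing 2k as m+4 avoids truncated
    subtraction.\<close>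
  have step: "summand_after_evens q t k - ?q k = ?j k - ?j (k - 1)" if k: "k \<in> {2..K}" for k
  proof -
    obtain l where l: "k = Suc (Suc l)" using k by (cases k; cases "k - 1") auto
    define m where "m = 2 * l"
    have m: "2 * k = Suc (Suc (Suc (Suc m)))" "2 * (k - 1) = Suc (Suc m)"
      and "even m" "m + 8 \<le> n"
      using k K by (auto simp: m_def l)
    then show ?thesis
      using J[unfolded has_current_def Let_def, rule_format,
          of "s ! Suc m" "s ! Suc (Suc m)" "s ! Suc (Suc (Suc m))" "s ! Suc (Suc (Suc (Suc m)))"
             "s ! Suc (Suc (Suc (Suc (Suc m))))" "s ! Suc (Suc (Suc (Suc (Suc (Suc m)))))"
             "s ! Suc (Suc (Suc (Suc (Suc (Suc (Suc m))))))"] len n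
      unfolding summand_after_evens_def m
      by (simp add: t_def nth_odds numeral_3_eq_3)
  qed
  have "(\<Sum>k=2..K. summand_after_evens q t k) - (\<Sum>k=2..K. ?q k) = (\<Sum>k=2..K. ?j k - ?j (k - 1))"
    unfolding sum_subtractf[symmetric] using step by (intro sum.cong refl) auto
  also have "\<dots> = ?j K - ?j 1"
    using sum_telescope''[of 1 K ?j] K(1) unfolding Suc_1 by simp
  finally have rest: "(\<Sum>k=2..K. summand_after_evens q t k) - (\<Sum>k=2..K. ?q k) = ?j K - ?j 1" .
  have Q: "Q_of q n s = ?q 1 + (\<Sum>k=2..K. ?q k)"
    unfolding split[of ?q, symmetric] by (simp add: Q_of_def site_def K_def)
  have right: "(\<lambda>w. J (w ! 3) (w ! 4) (w ! 5) (w ! 6) (w ! 7)) (drop (n - 8) s) = ?j K"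
  proof -
    have idx: "n - 8 + 3 = 2 * K - 1" "n - 8 + 4 = 2 * K" "n - 8 + 5 = 2 * K + 1"
      "n - 8 + 6 = 2 * K + 2" "n - 8 + 7 = 2 * K + 3"
      using K by auto
    have "drop (n - 8) s ! i = s ! (n - 8 + i)" for i
      by (simp add: len)
    then show ?thesis by (simp only: idx)
  qed
  have one: "?j 1 = J (s ! 1) (s ! 2) (s ! 3) (s ! 4) (s ! 5)"
    "?q 1 = q (s ! 1) (s ! 2) (s ! 3) (s ! 4)"
    by simp_all
  show ?thesis unfolding U first Q right using rest one by linarith
qed

section \<open>Currents of the two densities\<close>

lemma has_current_q_minus: "has_current q_minus (\<lambda>a b c d e. 4 * val c)"
  unfolding has_current_def Let_def
proof (intro allI)
  fix a b c d e f g
  show "q_minus (chi (chi a b c) c (chi c d e)) (chi c d e)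
         (chi (chi c d e) e (chi e f g)) (chi e f g) - q_minus c d e f = 4 * val e - 4 * val c"
    \<comment> \<open>Behind the case check: if \<open>d' = 1\<close>, the even update flips
      \<open>c\<close> and \<open>e\<close>, so the density changes by 4(d+d')(e-c). If
      \<open>c\<close> and \<open>e\<close> differ, then \<open>d'\<close> is the opposite of
      \<open>d\<close>, so d+d' = 1.\<close>
    by (cases a; cases b; cases c; cases d; cases e; cases f; cases g) (simp_all add: q_minus_def chi_def)
qed

text \<open>The current was found by linear algebra over the products of \<open>b\<close>, \<open>c\<close>, \<open>d\<close> and the updated
  values \<open>x\<close>, \<open>y\<close> of the second and fourth site.\<close>

definition J_plus :: current where
  "J_plus a b c d e = (let x = chi a b c; y = chi c d e in
     10 * val c - 8 * val b * val c - 4 * val c * val d - 4 * val x + 4 * val x * val y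
     - 8 * val c * val x * val y)"

text \<open>The auxiliary values \<open>x\<close>, \<open>y\<close> are \<open>d'\<close>,
  \<open>f'\<close> in the right-hand current and \<open>b'\<close>, \<open>d'\<close> in the
  left-hand one, so the identity relates values already present in \<open>has_current\<close>; it is
  checked on all 128 windows.\<close>

lemma has_current_q_plus: "has_current q_plus J_plus"
  unfolding has_current_def Let_def
proof (intro allI)
  fix a b c d e f g
  show "q_plus (chi (chi a b c) c (chi c d e)) (chi c d e)
         (chi (chi c d e) e (chi e f g)) (chi e f g) - q_plus c d e f
       = J_plus c d e f g - J_plus a b c d e"
    by (cases a; cases b; cases c; cases d; cases e; cases f; cases g)
       (simp_all add: q_plus_def J_plus_def chi_def)
qed

theorem mainTheorem5:
  fixes \<alpha> \<beta> \<gamma> \<delta> :: real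
  assumes "\<alpha> = \<beta>" and "\<alpha> \<in> {0..1}"
    and "\<gamma> = \<delta>" and "\<gamma> \<in> {0..1}"
  shows "\<exists>r'::nat. r' \<ge> 4 \<and> (\<forall>n\<ge>r'. even n \<longrightarrow>
    (\<exists>(g_plus::cvec) (h_plus::cvec) (g_minus::cvec) (h_minus::cvec). \<forall>s\<in>configs n.
       mvec n (U n \<alpha> \<beta> \<gamma> \<delta>) (Q_plus n) s - Q_plus n s
         = g_plus (take r' s) + h_plus (drop (n - r') s) \<and>
       mvec n (U n \<alpha> \<beta> \<gamma> \<delta>) (Q_minus n) s - Q_minus n s
         = g_minus (take r' s) + h_minus (drop (n - r') s)))"
  unfolding Q_plus_def Q_minus_def assms(1)[symmetric] assms(3)[symmetric]
proof (intro exI[of _ 8] conjI allI impI)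
  fix n :: nat
  assume n: "8 \<le> n" "even n"
  note plus = local_conservation[OF has_current_q_plus n, of _ \<alpha> \<gamma>]
    and minus = local_conservation[OF has_current_q_minus n, of _ \<alpha> \<gamma>]
  show "\<exists>(g_plus::cvec) (h_plus::cvec) (g_minus::cvec) (h_minus::cvec). \<forall>s\<in>configs n.
       mvec n (U n \<alpha> \<alpha> \<gamma> \<gamma>) (Q_of q_plus n) s - Q_of q_plus n s
         = g_plus (take 8 s) + h_plus (drop (n - 8) s) \<and>
       mvec n (U n \<alpha> \<alpha> \<gamma> \<gamma>) (Q_of q_minus n) s - Q_of q_minus n s
         = g_minus (take 8 s) + h_minus (drop (n - 8) s)"
    \<comment> \<open>Unification supplies the witnesses: \<open>left_part\<close> for each density
      on the left, and its current at positions 3 to 7 of the last eight sites on the right.\<close>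
    by (intro exI ballI conjI) (erule plus, erule minus)
qed simp

end
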